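(* Let $n$ be a positive integer and let $F:\{0,1\}^n\to\{0,1\}^n$ be a map. If $G_F(x)$ has no negative circuit for all $x\in\{0,1\}^n$, and if the out-degree of each vertex of $G_F(x)$ is at most one for all $x\in\{0,1\}^n$, then $F$ has at least one fixed point.
   Context: Write $F(x)=(f_1(x),\dots,f_n(x))$ for $x=(x_1,\dots,x_n)\in\{0,1\}^n$. For $i,j\in\{1,\dots,n\}$ and $x\in\{0,1\}^n$, set $$f_{ij}(x)=f_i(x_1,\dots,x_{j-1},1,x_{j+1},\dots,x_n)-f_i(x_1,\dots,x_{j-1},0,x_{j+1},\dots,x_n)\in\{-1,0,1\}.$$ The interaction graph $G_F(x)$ of $F$ evaluated at $x$ is the signed directed graph on the vertex set $\{1,\dots,n\}$ that contains an arc from $j$ to $i$ if and only if $f_{ij}(x)\neq 0$; the sign of this arc is $f_{ij}(x)$. Loops are allowed. A circuit of length $p\ge 1$ in $G_F(x)$ is a sequence of $p$ distinct vertices $i_1,\dots,i_p$ such that $G_F(x)$ has an arc from $i_k$ to $i_{k+1}$ for $1\le k<p$ and an arc from $i_p$ to $i_1$ (so a loop is a circuit of length one). The sign of a circuit in $G_F(x)$ is the product of the signs of its arcs in $G_F(x)$; the circuit is positive (resp. negative) if this product is $+1$ (resp. $-1$). The out-degree of a vertex $j$ in $G_F(x)$ is the number of vertices $i$ such that $G_F(x)$ has an arc from $j$ to $i$ (a loop at $j$ counts). *)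

theory Defs
  imports "HOL-Library.FuncSet" "Graph_Theory.Pair_Digraph"
begin

text \<open>
  Points of the cube are extensional functions on \<open>{1..n}\<close>, so that equality of two points
  is exactly equality of all \<open>n\<close> coordinates. The coordinates are integers because
  differences of coordinates are needed.
\<close>

definition bool_cube :: "nat \<Rightarrow> (nat \<Rightarrow> int) set" where
  "bool_cube n = {1..n} \<rightarrow>\<^sub>E {0, 1}"

text \<open>The discrete partial derivative \<open>f\<^sub>i\<^sub>j(x)\<close> of the \<open>i\<close>-th component with respect to
  the \<open>j\<close>-th variable.\<close>

definition discrete_deriv ::
    "((nat \<Rightarrow> int) \<Rightarrow> (nat \<Rightarrow> int)) \<Rightarrow> nat \<Rightarrow> nat \<Rightarrow> (nat \<Rightarrow> int) \<Rightarrow> int" where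
  "discrete_deriv F i j x = F (x(j := 1)) i - F (x(j := 0)) i"

text \<open>The pair \<open>(j, i)\<close> is the arc from \<open>j\<close> to \<open>i\<close>; note that the index order is reversed
  with respect to \<open>f\<^sub>i\<^sub>j\<close>. There is at most one arc from \<open>j\<close> to \<open>i\<close>, so the signs are kept
  separately, as a function of the arc.\<close>

definition interaction_graph ::
    "nat \<Rightarrow> ((nat \<Rightarrow> int) \<Rightarrow> (nat \<Rightarrow> int)) \<Rightarrow> (nat \<Rightarrow> int) \<Rightarrow> (nat, nat \<times> nat) pre_digraph" where
  "interaction_graph n F x = with_proj
     \<lparr> pverts = {1..n},
       parcs = {(j, i). j \<in> {1..n} \<and> i \<in> {1..n} \<and> discrete_deriv F i j x \<noteq> 0} \<rparr>"

definition arc_sign ::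
    "((nat \<Rightarrow> int) \<Rightarrow> (nat \<Rightarrow> int)) \<Rightarrow> (nat \<Rightarrow> int) \<Rightarrow> nat \<times> nat \<Rightarrow> int" where
  "arc_sign F x = (\<lambda>(j, i). discrete_deriv F i j x)"

text \<open>A circuit through the distinct vertices \<open>i\<^sub>1, \<dots>, i\<^sub>p\<close> is given by its list of arcs
  \<open>(i\<^sub>1, i\<^sub>2), \<dots>, (i\<^sub>p, i\<^sub>1)\<close>. The library's cycles are nonempty and include loops (\<open>p = 1\<close>).\<close>

definition negative_circuit ::
    "nat \<Rightarrow> ((nat \<Rightarrow> int) \<Rightarrow> (nat \<Rightarrow> int)) \<Rightarrow> (nat \<Rightarrow> int) \<Rightarrow> (nat \<times> nat) list \<Rightarrow> bool" where
  "negative_circuit n F x c \<longleftrightarrow>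
     pre_digraph.cycle (interaction_graph n F x) c \<and> prod_list (map (arc_sign F x) c) = - 1"

end

theory Submission
  imports Defs
begin

text \<open>
  Out-degree at most one says that \<open>F\<close> does not increase the Hamming distance. By induction on
  a set \<open>I\<close> of coordinates, the coordinates in \<open>I\<close> can be made fixed while those outside \<open>I\<close> are
  prescribed. If this fails when \<open>k\<close> is added to \<open>I\<close>, there are points \<open>x, y\<close> with \<open>x\<^sub>k = 0\<close>,
  \<open>y\<^sub>k = 1\<close> on each of which \<open>F\<close> acts, within \<open>I\<close>, as the flip of \<open>k\<close>. Take such a pair at
  minimal distance and let \<open>D\<close> be the set of coordinates where they differ. Then \<open>F\<close> preserves
  the distance between \<open>x\<close> and \<open>y\<close>, so it is rigid on the geodesics from \<open>x\<close> to \<open>y\<close>: flipping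
  \<open>j \<in> D\<close> at \<open>x\<close> changes exactly one coordinate \<open>\<sigma> j \<in> D\<close> of \<open>F x\<close>, and flipping a cycle \<open>C\<close> of
  \<open>\<sigma>\<close> changes exactly \<open>C\<close>. If \<open>k \<notin> C\<close>, flipping \<open>C\<close> brings \<open>x\<close> closer to \<open>y\<close>. Hence
  \<open>k \<in> C\<close>, and \<open>C\<close> is a negative circuit at \<open>x\<close>, because \<open>F\<close> reverses the coordinate \<open>k\<close> and
  no other.
\<close>

section \<open>Cycles of self-maps as cycles of digraphs\<close>

text \<open>The \<open>rotate1\<close> form yields both that \<open>\<sigma>\<close> permutes
  \<open>set js\<close> and the arcs of a closed walk.\<close>

lemma finite_self_map_cycle:
  fixes \<sigma> :: "'a \<Rightarrow> 'a"
  assumes "finite D" "D \<noteq> {}" "\<sigma> ` D \<subseteq> D"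
  obtains js where "js \<noteq> []" "distinct js" "set js \<subseteq> D" "map \<sigma> js = rotate1 js"
proof -
  obtain j0 where j0: "j0 \<in> D" using assms by blast
  have mem: "(\<sigma> ^^ m) j0 \<in> D" for m
    using j0 assms(3) by (induction m) auto
  have "\<not> inj (\<lambda>m. (\<sigma> ^^ m) j0)"
    using mem assms(1) by (metis finite_imageD finite_subset image_subsetI infinite_UNIV_nat)
  then obtain a b where ab: "a < b" "(\<sigma> ^^ a) j0 = (\<sigma> ^^ b) j0"
    unfolding inj_def by (metis linorder_neqE_nat)
  define j where "j = (\<sigma> ^^ a) j0"
  have "(\<sigma> ^^ (b - a)) j = (\<sigma> ^^ (b - a + a)) j0"
    unfolding j_def by (simp only: funpow_add comp_apply)
  also have "\<dots> = j" using ab by (simp add: j_def)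
  finally have ex: "\<exists>p>0. (\<sigma> ^^ p) j = j" using ab(1) by (intro exI[of _ "b - a"]) simp
  \<comment> \<open>Minimality of the return time makes the first \<open>p\<close> iterates
    distinct: a coincidence at \<open>l < m\<close> would give a return after
    \<open>p - m + l\<close> steps.\<close>
  define p where "p = (LEAST p. p > 0 \<and> (\<sigma> ^^ p) j = j)"
  have p: "p > 0" "(\<sigma> ^^ p) j = j"
    using LeastI_ex[OF ex] unfolding p_def by auto
  have least: "p \<le> q" if "q > 0" "(\<sigma> ^^ q) j = j" for q
    using that unfolding p_def by (simp add: Least_le)
  define js where "js = map (\<lambda>m. (\<sigma> ^^ m) j) [0..<p]"
  have "False" if "l < m" "m < p" "(\<sigma> ^^ l) j = (\<sigma> ^^ m) j" for l m
  proof -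
    have "(\<sigma> ^^ (p - m + l)) j = (\<sigma> ^^ (p - m)) ((\<sigma> ^^ m) j)"
      using that by (simp only: funpow_add comp_apply)
    also have "\<dots> = (\<sigma> ^^ (p - m + m)) j"
      by (simp only: funpow_add comp_apply)
    also have "\<dots> = j" using that p by simp
    finally show False using least[of "p - m + l"] that by linarith
  qed
  then have "distinct js"
    unfolding js_def distinct_map inj_on_def
    by (auto, metis linorder_neqE_nat)
  moreover have "js \<noteq> []" using p by (simp add: js_def)
  moreover have "set js \<subseteq> D"
    using mem[of "_ + a"] by (auto simp: js_def j_def funpow_add)
  moreover have "map \<sigma> js = rotate1 js"
  proof (rule nth_equalityI)
    fix i assume "i < length (map \<sigma> js)"
    then have "i < p" by (simp add: js_def)
    then show "map \<sigma> js ! i = rotate1 js ! i"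
      using p by (cases "Suc i = p") (auto simp: js_def nth_rotate1)
  qed simp
  ultimately show thesis using that by blast
qed

text \<open>The end vertex \<open>v\<close> is kept free for the induction; the closed walk has
  \<open>v = hd js\<close>.\<close>

lemma cas_functional_arcs:
  assumes "tail G = fst" "head G = snd" "map \<sigma> js = tl js @ [v]" "js \<noteq> []"
  shows "pre_digraph.cas G (hd js) (map (\<lambda>j. (j, \<sigma> j)) js) v"
    and "pre_digraph.awalk_verts G (hd js) (map (\<lambda>j. (j, \<sigma> j)) js) = js @ [v]"
  using assms(3,4)
proof (induction js)
  case (Cons a js)
  { case 1 then show ?case using Cons.IH assms(1,2)
      by (cases js) (auto simp: pre_digraph.cas.simps) }
  { case 2 then show ?case using Cons.IH assms(1,2)
      by (cases js) (auto simp: pre_digraph.awalk_verts.simps) }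
qed auto

lemma cycle_functional_arcs:
  assumes "tail G = fst" "head G = snd" "map \<sigma> js = rotate1 js" "js \<noteq> []" "distinct js"
    and "set js \<subseteq> verts G" "(\<lambda>j. (j, \<sigma> j)) ` set js \<subseteq> arcs G"
  shows "pre_digraph.cycle G (map (\<lambda>j. (j, \<sigma> j)) js)"
proof -
  have rot: "map \<sigma> js = tl js @ [hd js]" using assms(3,4) by (simp add: rotate1_hd_tl)
  note walk = cas_functional_arcs[OF assms(1,2) rot assms(4)]
  have "distinct (tl (js @ [hd js]))" using assms(4,5) by (cases js) auto
  moreover have "hd js \<in> verts G" using assms(4,6) by auto
  ultimately show ?thesis
    unfolding pre_digraph.cycle_def pre_digraph.awalk_def
    using walk assms(4,7) by (intro exI[of _ "hd js"]) auto
qed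

section \<open>Flips and differences on the cube\<close>

definition flip :: "'a set \<Rightarrow> ('a \<Rightarrow> int) \<Rightarrow> 'a \<Rightarrow> int" where
  "flip C x i = (if i \<in> C then 1 - x i else x i)"

text \<open>Its size is the Hamming distance restricted to \<open>I\<close>.\<close>

definition diff_on :: "'a set \<Rightarrow> ('a \<Rightarrow> 'b) \<Rightarrow> ('a \<Rightarrow> 'b) \<Rightarrow> 'a set" where
  "diff_on I x y = {i \<in> I. x i \<noteq> y i}"

lemma bool_cube_cases:
  assumes "x \<in> bool_cube n" "i \<in> {1..n}"
  obtains "x i = 0" | "x i = 1"
  using assms unfolding bool_cube_def by (blast dest: PiE_mem)

lemma bool_cube_neqD:
  assumes "x \<in> bool_cube n" "y \<in> bool_cube n" "i \<in> {1..n}" "x i \<noteq> y i"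
  shows "y i = 1 - x i"
  using assms by (metis bool_cube_cases diff_self diff_zero)

lemma flip_in_bool_cube:
  assumes "x \<in> bool_cube n" "C \<subseteq> {1..n}"
  shows "flip C x \<in> bool_cube n"
  using assms unfolding bool_cube_def flip_def
  by (fastforce simp: PiE_iff extensional_def)

lemma diff_on_flip_right:
  assumes "x \<in> bool_cube n" "C \<subseteq> {1..n}"
  shows "diff_on {1..n} x (flip C x) = C"
  using assms by (auto simp: diff_on_def flip_def) presburger

lemma diff_on_flip_left:
  assumes "x \<in> bool_cube n" "y \<in> bool_cube n" "C \<subseteq> diff_on {1..n} x y"
  shows "diff_on {1..n} (flip C x) y = diff_on {1..n} x y - C"
  using assms bool_cube_neqD[OF assms(1,2)]
  by (auto simp: diff_on_def flip_def)

text \<open>One of the two points in the derivative is \<open>x\<close>, the other its flip;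
  \<open>1 - 2 * x j\<close> restores the order of subtraction.\<close>

lemma discrete_deriv_flip:
  assumes "x \<in> bool_cube n" "j \<in> {1..n}"
  shows "discrete_deriv F i j x = (1 - 2 * x j) * (F (flip {j} x) i - F x i)"
  using assms(1,2)
proof (cases rule: bool_cube_cases)
  case 1
  then have "x(j := 1) = flip {j} x" "x(j := 0) = x" by (auto simp: flip_def)
  then show ?thesis using 1 by (simp add: discrete_deriv_def)
next
  case 2
  then have "x(j := 0) = flip {j} x" "x(j := 1) = x" by (auto simp: flip_def)
  then show ?thesis using 2 by (simp add: discrete_deriv_def)
qed

lemma interaction_graph_simps [simp]:
  "verts (interaction_graph n F x) = {1..n}"
  "arcs (interaction_graph n F x) =
     {(j, i). j \<in> {1..n} \<and> i \<in> {1..n} \<and> discrete_deriv F i j x \<noteq> 0}"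
  "tail (interaction_graph n F x) = fst"
  "head (interaction_graph n F x) = snd"
  by (auto simp: interaction_graph_def)

text \<open>Every coordinate changed by flipping \<open>j\<close> is the head of an arc leaving
  \<open>j\<close>.\<close>

lemma card_diff_on_flip_le:
  assumes "x \<in> bool_cube n" "j \<in> {1..n}" "I \<subseteq> {1..n}"
    and "out_degree (interaction_graph n F x) j \<le> 1"
  shows "card (diff_on I (F (flip {j} x)) (F x)) \<le> 1"
proof -
  let ?A = "out_arcs (interaction_graph n F x) j"
  have A: "?A = Pair j ` {i \<in> {1..n}. discrete_deriv F i j x \<noteq> 0}"
    using assms(2) by (auto simp: out_arcs_def)
  have "diff_on I (F (flip {j} x)) (F x) \<subseteq> {i \<in> {1..n}. discrete_deriv F i j x \<noteq> 0}"
    using assms(3) by (auto simp: diff_on_def discrete_deriv_flip[OF assms(1,2)]) presburger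
  then have "card (diff_on I (F (flip {j} x)) (F x))
      \<le> card {i \<in> {1..n}. discrete_deriv F i j x \<noteq> 0}"
    by (intro card_mono) auto
  also have "\<dots> = card ?A" unfolding A by (simp add: card_image inj_on_def)
  finally show ?thesis using assms(4) by (simp add: out_degree_def)
qed

section \<open>Hamming distance under \<open>F\<close>\<close>

lemma finite_diff_on [simp]: "finite I \<Longrightarrow> finite (diff_on I x y)"
  by (simp add: diff_on_def)

lemma diff_on_commute: "diff_on I x y = diff_on I y x"
  by (auto simp: diff_on_def)

lemma card_diff_on_triangle:
  assumes "finite I"
  shows "card (diff_on I x z) \<le> card (diff_on I x y) + card (diff_on I y z)"
proof -
  have "diff_on I x z \<subseteq> diff_on I x y \<union> diff_on I y z" by (auto simp: diff_on_def)
  then have "card (diff_on I x z) \<le> card (diff_on I x y \<union> diff_on I y z)"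
    using assms by (intro card_mono) auto
  then show ?thesis using card_Un_le order_trans by blast
qed

text \<open>Walk from \<open>x\<close> to \<open>y\<close>, flipping one differing coordinate at a
  time; each flip moves the image by at most one.\<close>

lemma nonexpansive:
  assumes out: "\<forall>x \<in> bool_cube n. \<forall>j \<in> verts (interaction_graph n F x).
           out_degree (interaction_graph n F x) j \<le> 1"
    and I: "I \<subseteq> {1..n}"
    and xy: "x \<in> bool_cube n" "y \<in> bool_cube n"
  shows "card (diff_on I (F x) (F y)) \<le> card (diff_on {1..n} x y)"
  using xy
proof (induction "card (diff_on {1..n} x y)" arbitrary: x)
  case 0
  then have "x i = y i" if "i \<in> {1..n}" for i using that by (auto simp: diff_on_def)
  then have "x = y" using 0 unfolding bool_cube_def by (intro PiE_ext) auto
  then show ?case by (simp add: diff_on_def)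
next
  case (Suc m)
  have "diff_on {1..n} x y \<noteq> {}" using Suc(2) by auto
  then obtain j where j: "j \<in> diff_on {1..n} x y" by blast
  then have jn: "j \<in> {1..n}" by (simp add: diff_on_def)
  let ?x = "flip {j} x"
  have x: "?x \<in> bool_cube n" using flip_in_bool_cube Suc.prems jn by simp
  have "diff_on {1..n} ?x y = diff_on {1..n} x y - {j}"
    using diff_on_flip_left Suc.prems j by simp
  then have m: "m = card (diff_on {1..n} ?x y)" using j Suc(2) by simp
  have "finite I" using I finite_subset by blast
  then have "card (diff_on I (F x) (F y))
      \<le> card (diff_on I (F x) (F ?x)) + card (diff_on I (F ?x) (F y))"
    by (rule card_diff_on_triangle)
  also have "\<dots> \<le> 1 + m"
    using card_diff_on_flip_le[OF Suc.prems(1) jn I, of F] out Suc.prems jn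
      Suc(1)[OF m x Suc.prems(2)] m
    by (simp add: diff_on_commute[of I "F x"] add_mono)
  finally show ?case using Suc(2) by simp
qed

section \<open>Producing a negative circuit\<close>

lemma negative_circuit_of_cycle:
  assumes x: "x \<in> bool_cube n"
    and js: "js \<noteq> []" "distinct js" "set js \<subseteq> {1..n}" "map \<sigma> js = rotate1 js"
    and k: "k \<in> set js"
    and Fx: "\<And>i. i \<in> set js \<Longrightarrow> F x i = flip {k} x i"
    and F\<sigma>: "\<And>j. j \<in> set js \<Longrightarrow> F (flip {j} x) (\<sigma> j) = 1 - F x (\<sigma> j)"
  shows "negative_circuit n F x (map (\<lambda>j. (j, \<sigma> j)) js)"
proof -
  \<comment> \<open>\<open>1 - 2 * t\<close> turns the values 0, 1 into the signs 1, -1. The sign of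
    an arc splits into a factor at its tail and one at its head.\<close>
  let ?e = "\<lambda>j. 1 - 2 * x j" and ?d = "\<lambda>i. 1 - 2 * F x i"
  have im: "\<sigma> ` set js = set js" using js(4) by (metis list.set_map set_rotate1)
  have inj: "inj_on \<sigma> (set js)" using js(2,4) by (metis distinct_map distinct1_rotate)
  have deriv: "discrete_deriv F (\<sigma> j) j x = ?e j * ?d (\<sigma> j)" if "j \<in> set js" for j
    using discrete_deriv_flip[OF x, of j F "\<sigma> j"] that F\<sigma> js(3) by (auto simp: algebra_simps)
  have sq: "?e j * ?d j = (if j = k then - 1 else 1)" if "j \<in> set js" for j
    using x subsetD[OF js(3) that] by (cases rule: bool_cube_cases) (auto simp: Fx[OF that] flip_def)
  have "prod_list (map (arc_sign F x) (map (\<lambda>j. (j, \<sigma> j)) js))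
      = (\<Prod>j\<in>set js. ?e j * ?d (\<sigma> j))"
    using js(2) deriv by (simp add: arc_sign_def prod.distinct_set_conv_list[symmetric] o_def)
  also have "\<dots> = (\<Prod>j\<in>set js. ?e j) * (\<Prod>j\<in>set js. ?d (\<sigma> j))"
    by (rule prod.distrib)
  \<comment> \<open>After reindexing by \<open>\<sigma>\<close>, the signs of the coordinates of \<open>x\<close> and \<open>F x\<close> cancel except at \<open>k\<close>.\<close>
  also have "(\<Prod>j\<in>set js. ?d (\<sigma> j)) = (\<Prod>j\<in>set js. ?d j)"
    using prod.reindex[OF inj, of ?d] im by (simp add: o_def)
  also have "(\<Prod>j\<in>set js. ?e j) * \<dots> = (\<Prod>j\<in>set js. ?e j * ?d j)"
    by (rule prod.distrib[symmetric])
  also have "\<dots> = (\<Prod>j\<in>set js. if j = k then - 1 else 1)"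
    by (rule prod.cong) (use sq in auto)
  also have "\<dots> = - 1" using k by simp
  finally have neg: "prod_list (map (arc_sign F x) (map (\<lambda>j. (j, \<sigma> j)) js)) = - 1" .
  have "discrete_deriv F (\<sigma> j) j x \<noteq> 0" if "j \<in> set js" for j
    unfolding deriv[OF that] mult_eq_0_iff by presburger
  moreover have "\<sigma> j \<in> {1..n}" if "j \<in> set js" for j using that im js(3) by blast
  ultimately have "(\<lambda>j. (j, \<sigma> j)) ` set js \<subseteq> arcs (interaction_graph n F x)"
    using js(3) by auto
  then have "pre_digraph.cycle (interaction_graph n F x) (map (\<lambda>j. (j, \<sigma> j)) js)"
    using js by (intro cycle_functional_arcs) simp_all
  then show ?thesis using neg by (simp add: negative_circuit_def)
qed

text \<open>Minimality of the pair becomes strong induction on the distance: \<open>y\<close> stays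
  while \<open>x\<close> moves towards it.\<close>

lemma antipodal_flips_give_negative_circuit:
  assumes F: "F \<in> bool_cube n \<rightarrow> bool_cube n"
    and out: "\<forall>x \<in> bool_cube n. \<forall>j \<in> verts (interaction_graph n F x).
           out_degree (interaction_graph n F x) j \<le> 1"
    and I: "I \<subseteq> {1..n}"
    and x: "x \<in> bool_cube n" "\<And>i. i \<in> I \<Longrightarrow> F x i = flip {k} x i"
    and y: "y \<in> bool_cube n" "\<And>i. i \<in> I \<Longrightarrow> F y i = flip {k} y i"
    and xy: "diff_on {1..n} x y \<subseteq> I" "k \<in> diff_on {1..n} x y"
  shows "\<exists>x \<in> bool_cube n. \<exists>c. negative_circuit n F x c"
  using x xy
proof (induction "card (diff_on {1..n} x y)" arbitrary: x rule: less_induct)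
  case less
  define D where "D = diff_on {1..n} x y"
  define u where "u C = diff_on I (F (flip C x)) (F x)" for C
  note x = less.prems(1,2)
  have finI: "finite I" using I finite_subset by blast
  have D: "D \<subseteq> I" "k \<in> D" "finite D" "D \<subseteq> {1..n}"
    using less.prems I by (auto simp: D_def diff_on_def)
  note nonexp = nonexpansive[OF out I]
  \<comment> \<open>Both images flip \<open>k\<close>, so the two flips cancel in the
    comparison.\<close>
  have FD: "F x i \<noteq> F y i \<longleftrightarrow> i \<in> D" if "i \<in> I" for i
    using x(2)[OF that] y(2)[OF that] that I by (auto simp: D_def diff_on_def flip_def)
  \<comment> \<open>\<open>flip C x\<close> lies on a geodesic from \<open>x\<close> to
    \<open>y\<close>. Nonexpansiveness bounds its image from both ends, and both bounds are tight
    because the images of the ends are at distance \<open>card D\<close> within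
    \<open>I\<close>.\<close>
  have u: "u C \<subseteq> D \<and> card (u C) = card C" if C: "C \<subseteq> D" for C
  proof -
    let ?z = "flip C x"
    have z: "?z \<in> bool_cube n" using C D flip_in_bool_cube x by blast
    have fin: "finite (u C)" "finite C" using finI C D finite_subset by (auto simp: u_def)
    have "card (u C) \<le> card (diff_on {1..n} x ?z)"
      using nonexp[OF x(1) z] by (simp add: u_def diff_on_commute)
    then have 1: "card (u C) \<le> card C"
      using diff_on_flip_right[OF x(1), of C] C D by simp
    \<comment> \<open>At such a coordinate exactly one of \<open>F ?z\<close> and \<open>F y\<close>
      departs from \<open>F x\<close>.\<close>
    have "(D - u C) \<union> (u C - D) \<subseteq> diff_on I (F ?z) (F y)"
      using FD D by (fastforce simp: u_def diff_on_def)
    then have "card ((D - u C) \<union> (u C - D)) \<le> card (diff_on I (F ?z) (F y))"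
      using finI by (intro card_mono) auto
    also have "\<dots> \<le> card (diff_on {1..n} ?z y)" by (rule nonexp[OF z y(1)])
    also have "\<dots> = card D - card C"
      using diff_on_flip_left[OF x(1) y(1), of C] C fin by (simp add: D_def card_Diff_subset)
    finally have 2: "card (D - u C) + card (u C - D) \<le> card D - card C"
      using fin D by (subst (asm) card_Un_disjoint) auto
    have 3: "card D = card (D - u C) + card (D \<inter> u C)"
      using D by (metis add.commute card_Int_Diff)
    have 4: "card (u C) = card (u C - D) + card (D \<inter> u C)"
      using fin by (metis add.commute card_Int_Diff inf_commute)
    have 5: "card C \<le> card D" using C D by (simp add: card_mono)
    have "card (u C - D) = 0" "card (u C) = card C" using 1 2 3 4 5 by linarith+
    then show ?thesis using fin by auto
  qed
  have "\<exists>i. u {j} = {i}" if "j \<in> D" for j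
    using u[of "{j}"] that by (simp add: card_1_singleton_iff)
  then obtain \<sigma> where \<sigma>: "u {j} = {\<sigma> j}" if "j \<in> D" for j by metis
  have "\<sigma> j \<in> D" if "j \<in> D" for j
    using u[of "{j}"] \<sigma>[OF that] that by simp
  then have \<sigma>D: "\<sigma> ` D \<subseteq> D" by blast
  obtain js where js: "js \<noteq> []" "distinct js" "set js \<subseteq> D" "map \<sigma> js = rotate1 js"
    using finite_self_map_cycle[OF D(3) _ \<sigma>D] D(2) by blast
  let ?C = "set js"
  show ?case
  proof (cases "k \<in> ?C")
    case True
    have "F (flip {j} x) (\<sigma> j) = 1 - F x (\<sigma> j)" if "j \<in> ?C" for j
    proof (rule bool_cube_neqD)
      have j: "j \<in> D" using that js by blast
      show "F x \<in> bool_cube n" using F x by blast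
      show "F (flip {j} x) \<in> bool_cube n" using F flip_in_bool_cube[OF x(1), of "{j}"] D j by blast
      have "\<sigma> j \<in> u {j}" using \<sigma>[OF j] by simp
      then show "\<sigma> j \<in> {1..n}" "F x (\<sigma> j) \<noteq> F (flip {j} x) (\<sigma> j)"
        using I by (auto simp: u_def diff_on_def)
    qed
    then have "negative_circuit n F x (map (\<lambda>j. (j, \<sigma> j)) js)"
      using js D True x by (intro negative_circuit_of_cycle) blast+
    then show ?thesis using x by blast
  next
    case False
    let ?z = "flip ?C x"
    have z: "?z \<in> bool_cube n" using js D flip_in_bool_cube x by blast
    \<comment> \<open>Otherwise flipping \<open>j\<close> alone undoes none of the
      \<open>card ?C\<close> changes, yet \<open>?w\<close> and \<open>?z\<close> differ only on
      \<open>?C - {j}\<close>.\<close>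
    have "\<sigma> j \<in> u ?C" if j: "j \<in> ?C" for j
    proof (rule ccontr)
      assume *: "\<sigma> j \<notin> u ?C"
      have jD: "j \<in> D" using j js by blast
      let ?w = "flip {j} x"
      have w: "?w \<in> bool_cube n" using D jD flip_in_bool_cube x by blast
      have "u ?C \<subseteq> diff_on I (F ?w) (F ?z)"
      proof
        fix i assume i: "i \<in> u ?C"
        then have "i \<notin> u {j}" using * \<sigma>[OF jD] by auto
        with i show "i \<in> diff_on I (F ?w) (F ?z)" by (auto simp: u_def diff_on_def)
      qed
      then have "card (u ?C) \<le> card (diff_on I (F ?w) (F ?z))"
        using finI by (intro card_mono) auto
      also have "\<dots> \<le> card (diff_on {1..n} ?w ?z)" by (rule nonexp[OF w z])
      also have "\<dots> \<le> card (?C - {j})"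
        using j by (intro card_mono) (auto simp: diff_on_def flip_def split: if_splits)
      also have "\<dots> < card ?C" using j by (intro psubset_card_mono) auto
      finally show False using u[OF js(3)] by simp
    qed
    then have "\<sigma> ` ?C \<subseteq> u ?C" by (rule image_subsetI)
    moreover have "\<sigma> ` ?C = ?C" using js(4) by (metis list.set_map set_rotate1)
    ultimately have "?C \<subseteq> u ?C" by simp
    then have uC: "u ?C = ?C"
      using u[OF js(3)] card_subset_eq[of "u ?C" ?C] finite_subset[OF _ D(3)] by simp
    \<comment> \<open>Within \<open>I\<close>, point and image are both flipped exactly on
      \<open>?C\<close>, which avoids \<open>k\<close>; so \<open>?z\<close> inherits the property
      of \<open>x\<close>.\<close>
    have Fz: "F ?z i = flip {k} ?z i" if i: "i \<in> I" for i
    proof (cases "i \<in> ?C")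
      case True
      then have "i \<in> u ?C" using uC by simp
      then have "F x i \<noteq> F ?z i" by (auto simp: u_def diff_on_def)
      then have "F ?z i = 1 - F x i"
        using bool_cube_neqD[of "F x" n "F ?z" i] F x z i I by blast
      then show ?thesis using True False x(2)[OF i] by (auto simp: flip_def)
    next
      case False
      then have "i \<notin> u ?C" using uC by simp
      then have "F ?z i = F x i" using i by (auto simp: u_def diff_on_def)
      then show ?thesis using False x(2)[OF i] by (auto simp: flip_def)
    qed
    have zy: "diff_on {1..n} ?z y = D - ?C"
      using diff_on_flip_left[OF x(1) y(1), of ?C] js by (simp add: D_def)
    \<comment> \<open>\<open>?C\<close> is nonempty, so the distance to \<open>y\<close> drops
      strictly.\<close>
    have "D \<inter> ?C \<noteq> {}" using js(1,3) by (simp add: Int_absorb1)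
    then have "card (diff_on {1..n} ?z y) < card (diff_on {1..n} x y)"
      unfolding zy D_def[symmetric] using D(3) by (intro psubset_card_mono) blast+
    moreover have "diff_on {1..n} ?z y \<subseteq> I" "k \<in> diff_on {1..n} ?z y"
      unfolding zy using D False by blast+
    ultimately show ?thesis using less.hyps[OF _ z Fz] by blast
  qed
qed

section \<open>Induction on the set of fixed coordinates\<close>

text \<open>Prescribing the values outside \<open>I\<close> lets the induction hypothesis supply one
  point for each value of the new coordinate.\<close>

lemma fixed_point_on_coordinates:
  assumes F: "F \<in> bool_cube n \<rightarrow> bool_cube n"
    and nocirc: "\<forall>x \<in> bool_cube n. \<not> (\<exists>c. negative_circuit n F x c)"
    and out: "\<forall>x \<in> bool_cube n. \<forall>j \<in> verts (interaction_graph n F x).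
           out_degree (interaction_graph n F x) j \<le> 1"
    and "finite I" "I \<subseteq> {1..n}" "z \<in> bool_cube n"
  shows "\<exists>x \<in> bool_cube n. (\<forall>i. i \<notin> I \<longrightarrow> x i = z i) \<and> (\<forall>i\<in>I. F x i = x i)"
  using assms(4-6)
proof (induction I arbitrary: z rule: finite_induct)
  case empty
  then show ?case by blast
next
  case (insert k I)
  then have k: "k \<in> {1..n}" "I \<subseteq> {1..n}" by auto
  have ex: "\<exists>x \<in> bool_cube n. x k = v \<and> (\<forall>i. i \<notin> insert k I \<longrightarrow> x i = z i) \<and> (\<forall>i\<in>I. F x i = x i)"
    if "v \<in> {0, 1}" for v
  proof -
    have "z(k := v) \<in> bool_cube n"
      using insert.prems that k by (auto simp: bool_cube_def PiE_iff extensional_def)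
    from insert.IH[OF k(2) this] obtain x where "x \<in> bool_cube n"
        "\<And>i. i \<notin> I \<Longrightarrow> x i = (z(k := v)) i" "\<forall>i\<in>I. F x i = x i" by blast
    then show ?thesis using insert.hyps(2) by (intro bexI[of _ x]) auto
  qed
  obtain x where x: "x \<in> bool_cube n" "x k = 0" "\<And>i. i \<notin> insert k I \<Longrightarrow> x i = z i"
      "\<And>i. i \<in> I \<Longrightarrow> F x i = x i" using ex[of 0] by auto
  obtain y where y: "y \<in> bool_cube n" "y k = 1" "\<And>i. i \<notin> insert k I \<Longrightarrow> y i = z i"
      "\<And>i. i \<in> I \<Longrightarrow> F y i = y i" using ex[of 1] by auto
  have flipk: "F w i = flip {k} w i"
    if "w \<in> bool_cube n" "F w k \<noteq> w k" "\<And>i. i \<in> I \<Longrightarrow> F w i = w i" "i \<in> insert k I" for w i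
  proof (cases "i = k")
    case True
    have "F w \<in> bool_cube n" using F that by blast
    then show ?thesis using bool_cube_neqD[OF that(1) _ k(1)] that(2) True by (simp add: flip_def)
  qed (use that in \<open>auto simp: flip_def\<close>)
  show ?case
  proof (rule ccontr)
    \<comment> \<open>Neither candidate is fixed at \<open>k\<close>, so at both \<open>F\<close>
      flips \<open>k\<close> alone among \<open>insert k I\<close>.\<close>
    assume neg: "\<not> ?case"
    have "F x k \<noteq> x k" using neg x by blast
    moreover have "F y k \<noteq> y k" using neg y by blast
    moreover have "diff_on {1..n} x y \<subseteq> insert k I"
    proof
      fix i assume "i \<in> diff_on {1..n} x y"
      then have "x i \<noteq> y i" by (simp add: diff_on_def)
      then show "i \<in> insert k I" using x(3)[of i] y(3)[of i] by metis
    qed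
    moreover have "k \<in> diff_on {1..n} x y" using x y k by (simp add: diff_on_def)
    ultimately have "\<exists>x \<in> bool_cube n. \<exists>c. negative_circuit n F x c"
      using flipk x(1,4) y(1,4) insert.prems(1)
      by (intro antipodal_flips_give_negative_circuit[OF F out, of "insert k I" x k y]) blast+
    then show False using nocirc by blast
  qed
qed

theorem theorem3:
  fixes n :: nat and F :: "(nat \<Rightarrow> int) \<Rightarrow> (nat \<Rightarrow> int)"
  assumes "n \<ge> 1"
    and "F \<in> bool_cube n \<rightarrow> bool_cube n"
    and "\<forall>x \<in> bool_cube n. \<not> (\<exists>c. negative_circuit n F x c)"
    and "\<forall>x \<in> bool_cube n. \<forall>j \<in> verts (interaction_graph n F x).
           out_degree (interaction_graph n F x) j \<le> 1"
  shows "\<exists>x \<in> bool_cube n. F x = x"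
proof -
  \<comment> \<open>An arbitrary point of the cube: no index in \<open>{1..n}\<close> is left to be
    prescribed.\<close>
  have "(\<lambda>i\<in>{1..n}. 0) \<in> bool_cube n" by (auto simp: bool_cube_def)
  then obtain x where x: "x \<in> bool_cube n" "\<forall>i\<in>{1..n}. F x i = x i"
    using fixed_point_on_coordinates[OF assms(2-4), of "{1..n}"] by blast
  then have "F x \<in> bool_cube n" using assms(2) by blast
  with x have "F x = x" unfolding bool_cube_def by (intro PiE_ext) auto
  with x show ?thesis by blast
qed

end
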